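(* There exists a one-sided error $\alpha$-erasure-resilient $\varepsilon$-tester for monotonicity of real-valued functions on the hypergrid $[n]^d$ that works for all $\alpha,\varepsilon\in(0,1)$ with $\alpha\le\varepsilon/(250d)$, with query complexity $O\!\left(\frac{d\log n}{\varepsilon(1-\alpha)}\right)$.
   Context: The hypergrid $[n]^d$ has the partial order $x\preceq y$ iff $x_i\le y_i$ for all $i\in[d]$; $f$ is monotone if $x\preceq y$ implies $f(x)\le f(y)$. An $\alpha$-erased function $f:[n]^d\to\mathbb{R}\cup\{\perp\}$ equals $\perp$ (erased) on at most an $\alpha$ fraction of the domain, with nonerased set $\mathcal{N}$; a restoration is a real-valued function agreeing with $f$ on $\mathcal{N}$. An $\alpha$-erasure-resilient $\varepsilon$-tester, with query access to $f$ (queries return $f(x)$ or $\perp$; $\mathcal{N}$ unknown), with probability at least $2/3$ accepts if some restoration is monotone and rejects if every restoration must be changed on at least an $\varepsilon$ fraction of $\mathcal{N}$ to become monotone; one-sided error means it always accepts in the first case. Query complexity is the worst case number of queries. *)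

theory Defs
  imports "HOL-Probability.Probability"
begin

text \<open>
  A randomized adaptive query algorithm with Boolean output (\<open>True\<close> = accept). A query to
  \<open>x\<close> returns \<open>f x\<close>, where \<open>None\<close> stands for the erasure symbol; the continuation
  may depend on the answer. \<open>Flip\<close> continues with a randomly chosen algorithm.
  Randomness is discrete, but it may be used at any point of the computation. As this is a
  datatype, every computation path is finite.
\<close>

datatype (query_points: 'x, dead 'y) query_alg =
    Output bool
  | Flip "('x, 'y) query_alg pmf"
  | Query 'x "'y option \<Rightarrow> ('x, 'y) query_alg"

text \<open>Joint distribution of the output and of the number of queries made on input \<open>f\<close>.\<close>

primrec run :: "('x \<Rightarrow> 'y option) \<Rightarrow> ('x, 'y) query_alg \<Rightarrow> (bool \<times> nat) pmf" where
  "run f (Output b) = return_pmf (b, 0)"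
| "run f (Flip p) = join_pmf (map_pmf (run f) p)"
| "run f (Query x k) = map_pmf (\<lambda>(b, q). (b, Suc q)) (run f (k (f x)))"

definition prob_output :: "('x \<Rightarrow> 'y option) \<Rightarrow> ('x, 'y) query_alg \<Rightarrow> bool \<Rightarrow> real" where
  "prob_output f A b = pmf (map_pmf fst (run f A)) b"

text \<open>In the following, \<open>D\<close> is the (finite) domain of the function under test. Functions
  are total in HOL; their values outside \<open>D\<close> are irrelevant.\<close>

definition nonerased :: "'x set \<Rightarrow> ('x \<Rightarrow> 'y option) \<Rightarrow> 'x set" where
  "nonerased D f = {x \<in> D. f x \<noteq> None}"

definition erased_fun :: "real \<Rightarrow> 'x set \<Rightarrow> ('x \<Rightarrow> 'y option) \<Rightarrow> bool" where
  "erased_fun \<alpha> D f \<longleftrightarrow> real (card {x \<in> D. f x = None}) \<le> \<alpha> * real (card D)"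

definition restorations :: "'x set \<Rightarrow> ('x \<Rightarrow> 'y option) \<Rightarrow> ('x \<Rightarrow> 'y) set" where
  "restorations D f = {g. \<forall>x \<in> nonerased D f. f x = Some (g x)}"

definition restorable :: "'x set \<Rightarrow> (('x \<Rightarrow> 'y) \<Rightarrow> bool) \<Rightarrow> ('x \<Rightarrow> 'y option) \<Rightarrow> bool" where
  "restorable D P f \<longleftrightarrow> (\<exists>g \<in> restorations D f. P g)"

definition far_from ::
  "'x set \<Rightarrow> (('x \<Rightarrow> 'y) \<Rightarrow> bool) \<Rightarrow> real \<Rightarrow> ('x \<Rightarrow> 'y option) \<Rightarrow> bool" where
  "far_from D P \<epsilon> f \<longleftrightarrow>
     (\<forall>g \<in> restorations D f. \<forall>h. P h \<longrightarrow>
        real (card {x \<in> nonerased D f. g x \<noteq> h x}) \<ge> \<epsilon> * real (card (nonerased D f)))"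

definition erasure_resilient_tester ::
  "'x set \<Rightarrow> (('x \<Rightarrow> 'y) \<Rightarrow> bool) \<Rightarrow> real \<Rightarrow> real \<Rightarrow> ('x, 'y) query_alg \<Rightarrow> bool" where
  "erasure_resilient_tester D P \<alpha> \<epsilon> A \<longleftrightarrow>
     query_points A \<subseteq> D \<and>
     (\<forall>f. erased_fun \<alpha> D f \<longrightarrow>
        (restorable D P f \<longrightarrow> prob_output f A True \<ge> 2/3) \<and>
        (far_from D P \<epsilon> f \<longrightarrow> prob_output f A False \<ge> 2/3))"

definition one_sided ::
  "'x set \<Rightarrow> (('x \<Rightarrow> 'y) \<Rightarrow> bool) \<Rightarrow> real \<Rightarrow> ('x, 'y) query_alg \<Rightarrow> bool" where
  "one_sided D P \<alpha> A \<longleftrightarrow>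
     (\<forall>f. erased_fun \<alpha> D f \<longrightarrow> restorable D P f \<longrightarrow> prob_output f A True = 1)"

text \<open>Worst case over all \<open>\<alpha>\<close>-erased inputs and all outcomes of the random choices.\<close>

definition query_complexity :: "'x set \<Rightarrow> real \<Rightarrow> ('x, 'y) query_alg \<Rightarrow> ereal" where
  "query_complexity D \<alpha> A =
     (SUP f \<in> {f. erased_fun \<alpha> D f}. SUP (b, q) \<in> set_pmf (run f A). ereal (real q))"

definition hypergrid :: "nat \<Rightarrow> nat \<Rightarrow> (nat \<Rightarrow> nat) set" where
  "hypergrid n d = ({1..d} \<rightarrow>\<^sub>E {1..n})"

definition grid_le :: "nat \<Rightarrow> (nat \<Rightarrow> nat) \<Rightarrow> (nat \<Rightarrow> nat) \<Rightarrow> bool" where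
  "grid_le d x y \<longleftrightarrow> (\<forall>i \<in> {1..d}. x i \<le> y i)"

definition grid_monotone :: "nat \<Rightarrow> nat \<Rightarrow> ((nat \<Rightarrow> nat) \<Rightarrow> real) \<Rightarrow> bool" where
  "grid_monotone n d g \<longleftrightarrow> monotone_on (hypergrid n d) (grid_le d) (\<le>) g"

end

theory Submission
  imports Defs
begin


text \<open>
  The tester is non-adaptive: it samples pairs of points on a common axis-parallel line, with
  probability decaying like the inverse of their distance, and rejects when it sees a violation.

  On a line, if \<open>x < y\<close> is a violated pair, then every nonerased point between them is in violation
  with \<open>x\<close> or with \<open>y\<close>. So, unless more than half of the interval is erased, one of the two has
  constant weight on its violated pairs. By a rising sun argument only twice as many points as there
  are erased ones start an interval that is mostly erased. Hence few points outside the
  heavily violated ones must be deleted to remove all violations along lines.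

  It remains to bound the Hamming distance to monotonicity by the number of deletions that remove
  the violations along lines, summed over the directions, up to a factor 4. For Boolean functions
  this holds with a factor 2, by sorting the directions one after the other: sorting is a contraction
  and preserves monotonicity in the other directions. A real-valued function is compared with its
  \<open>L\<^sup>1\<close>-closest monotone function \<open>h\<close>. On each level set of \<open>h\<close>, optimality says
  that the Boolean functions \<open>f > h\<close> and \<open>f \<ge> h\<close> are as far from monotone as their
  numbers of points with \<open>f > h\<close> and \<open>f < h\<close>, and since the level sets are disjoint, so are the
  deletions charged to them.
\<close>

section \<open>Monotone regression in the \<open>L^1\<close> norm\<close>

text \<open>Take \<open>h\<close> closest to \<open>f\<close> among integer-valued monotone
  functions. Raising it by one on an up-closed part \<open>U\<close> of its level set
  \<open>c\<close> keeps it monotone, because integer values above \<open>c\<close> are at least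
  \<open>c + 1\<close>. The cost drops by one where \<open>f x > c\<close> and grows by one
  elsewhere on \<open>U\<close>, so optimality gives the first inequality. Lowering on down-closed
  parts gives the second.\<close>

lemma median_regression:
  fixes f :: "'a \<Rightarrow> int"
  assumes "finite D" and trans: "\<And>x y z. le x y \<Longrightarrow> le y z \<Longrightarrow> le x z"
  obtains h :: "'a \<Rightarrow> int" where "monotone_on D le (\<le>) h"
    and "\<And>c U. U \<subseteq> {x \<in> D. h x = c} \<Longrightarrow> (\<And>x y. x \<in> U \<Longrightarrow> y \<in> D \<Longrightarrow> h y = c \<Longrightarrow> le x y \<Longrightarrow> y \<in> U) \<Longrightarrow>
           card {x \<in> U. f x > c} \<le> card {x \<in> U. f x \<le> c}"
    and "\<And>c U. U \<subseteq> {x \<in> D. h x = c} \<Longrightarrow> (\<And>x y. x \<in> U \<Longrightarrow> y \<in> D \<Longrightarrow> h y = c \<Longrightarrow> le y x \<Longrightarrow> y \<in> U) \<Longrightarrow>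
           card {x \<in> U. f x < c} \<le> card {x \<in> U. f x \<ge> c}"
proof -
  define cost where "cost h = (\<Sum>x\<in>D. nat \<bar>f x - h x\<bar>)" for h
  \<comment> \<open>Costs are natural numbers, so well-ordering yields a minimiser; the constant
    function 0 is a candidate.\<close>
  have "\<exists>h. monotone_on D le (\<le>) h \<and> (\<forall>k. monotone_on D le (\<le>) k \<longrightarrow> cost h \<le> cost k)"
    using ex_has_least_nat[of "\<lambda>h. monotone_on D le (\<le>) h" "\<lambda>_. 0" cost]
    by (auto simp: monotone_on_def)
  then obtain h where h: "monotone_on D le (\<le>) h"
    and opt: "\<And>k. monotone_on D le (\<le>) k \<Longrightarrow> cost h \<le> cost k" by blast
  have icost: "int (cost h) = (\<Sum>x\<in>D. \<bar>f x - h x\<bar>)" for h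
    by (simp add: cost_def)
  have shift: "(\<Sum>x\<in>U. \<bar>f x - h x\<bar>) \<le> (\<Sum>x\<in>U. \<bar>f x - k x\<bar>)"
    if "monotone_on D le (\<le>) k" "U \<subseteq> D" "\<And>x. x \<in> D - U \<Longrightarrow> k x = h x" for k U
  proof -
    have split: "(\<Sum>x\<in>D. \<bar>f x - g x\<bar>) = (\<Sum>x\<in>D - U. \<bar>f x - g x\<bar>) + (\<Sum>x\<in>U. \<bar>f x - g x\<bar>)" for g
      by (rule sum.subset_diff) (use that assms in auto)
    have "int (cost h) \<le> int (cost k)" using opt[OF that(1)] by simp
    moreover have "(\<Sum>x\<in>D - U. \<bar>f x - k x\<bar>) = (\<Sum>x\<in>D - U. \<bar>f x - h x\<bar>)"
      using that(3) by (intro sum.cong) auto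
    ultimately show ?thesis unfolding icost split by simp
  qed
  have count: "card {x \<in> U. P x} \<le> card {x \<in> U. \<not> P x}"
    if "finite U" "0 \<le> (\<Sum>x\<in>U. if P x then - 1 else 1 :: int)" for U :: "'a set" and P
  proof -
    have "(\<Sum>x\<in>U. if P x then - 1 else 1 :: int) = - int (card {x \<in> U. P x}) + int (card {x \<in> U. \<not> P x})"
      using that(1) by (simp add: sum.If_cases Int_def Collect_neg_eq)
    then show ?thesis using that(2) by linarith
  qed
  show thesis
  proof
    show "monotone_on D le (\<le>) h" by fact
  next
    fix c U
    assume U: "U \<subseteq> {x \<in> D. h x = c}"
      and up: "\<And>x y. x \<in> U \<Longrightarrow> y \<in> D \<Longrightarrow> h y = c \<Longrightarrow> le x y \<Longrightarrow> y \<in> U"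
    define k where "k x = (if x \<in> U then c + 1 else h x)" for x
    have "k x \<le> k y" if "x \<in> D" "y \<in> D" "le x y" for x y
    proof (cases "x \<in> U")
      case True
      then have "h x = c" "h x \<le> h y" using U that monotone_onD[OF h] by auto
      then show ?thesis using up[OF True that(2) _ that(3)] True
        by (cases "h y = c") (auto simp: k_def)
    next
      case False
      then show ?thesis using U that monotone_onD[OF h that] by (auto simp: k_def)
    qed
    then have "(\<Sum>x\<in>U. \<bar>f x - h x\<bar>) \<le> (\<Sum>x\<in>U. \<bar>f x - k x\<bar>)"
      using U by (intro shift) (auto simp: k_def monotone_on_def)
    then have "0 \<le> (\<Sum>x\<in>U. \<bar>f x - k x\<bar> - \<bar>f x - h x\<bar>)" by (simp add: sum_subtractf)
    also have "\<dots> = (\<Sum>x\<in>U. if f x > c then - 1 else 1)"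
      using U by (intro sum.cong) (auto simp: k_def)
    finally have "card {x \<in> U. f x > c} \<le> card {x \<in> U. \<not> f x > c}"
      using U assms(1) by (intro count) (auto intro: finite_subset)
    then show "card {x \<in> U. f x > c} \<le> card {x \<in> U. f x \<le> c}" by (simp add: not_less)
  next
    fix c U
    assume U: "U \<subseteq> {x \<in> D. h x = c}"
      and down: "\<And>x y. x \<in> U \<Longrightarrow> y \<in> D \<Longrightarrow> h y = c \<Longrightarrow> le y x \<Longrightarrow> y \<in> U"
    define k where "k x = (if x \<in> U then c - 1 else h x)" for x
    have "k x \<le> k y" if "x \<in> D" "y \<in> D" "le x y" for x y
    proof (cases "y \<in> U")
      case True
      then have "h y = c" "h x \<le> h y" using U that monotone_onD[OF h] by auto
      then show ?thesis using down[OF True that(1) _ that(3)] True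
        by (cases "h x = c") (auto simp: k_def)
    next
      case False
      then show ?thesis using U that monotone_onD[OF h that] by (auto simp: k_def)
    qed
    then have "(\<Sum>x\<in>U. \<bar>f x - h x\<bar>) \<le> (\<Sum>x\<in>U. \<bar>f x - k x\<bar>)"
      using U by (intro shift) (auto simp: k_def monotone_on_def)
    then have "0 \<le> (\<Sum>x\<in>U. \<bar>f x - k x\<bar> - \<bar>f x - h x\<bar>)" by (simp add: sum_subtractf)
    also have "\<dots> = (\<Sum>x\<in>U. if f x < c then - 1 else 1)"
      using U by (intro sum.cong) (auto simp: k_def)
    finally have "card {x \<in> U. f x < c} \<le> card {x \<in> U. \<not> f x < c}"
      using U assms(1) by (intro count) (auto intro: finite_subset)
    then show "card {x \<in> U. f x < c} \<le> card {x \<in> U. f x \<ge> c}" by (simp add: not_less)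
  qed
qed

section \<open>Axis-parallel lines of the hypergrid\<close>

lemma finite_hypergrid [simp]: "finite (hypergrid n d)"
  by (simp add: hypergrid_def finite_PiE)

lemma hypergrid_upd:
  "x \<in> hypergrid n d \<Longrightarrow> i \<in> {1..d} \<Longrightarrow> v \<in> {1..n} \<Longrightarrow> x(i := v) \<in> hypergrid n d"
  by (auto simp: hypergrid_def PiE_iff extensional_def)

lemma hypergrid_coord: "x \<in> hypergrid n d \<Longrightarrow> i \<in> {1..d} \<Longrightarrow> x i \<in> {1..n}"
  by (auto simp: hypergrid_def PiE_iff)

definition line_section :: "nat \<Rightarrow> nat \<Rightarrow> (nat \<Rightarrow> nat) set \<Rightarrow> (nat \<Rightarrow> nat) \<Rightarrow> nat set" where
  "line_section n i A x = {u \<in> {1..n}. x(i := u) \<in> A}"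

lemma line_section_upd [simp]: "line_section n i A (x(i := v)) = line_section n i A x"
  by (simp add: line_section_def)

lemma finite_line_section [simp]: "finite (line_section n i A x)"
  by (simp add: line_section_def)

text \<open>Each line in direction \<open>i\<close> is named by its unique point with
  \<open>i\<close>-th coordinate 1, and a point of \<open>A\<close> is determined by its line and
  its \<open>i\<close>-th coordinate.\<close>

lemma card_by_lines:
  assumes "i \<in> {1..d}" "A \<subseteq> hypergrid n d"
  shows "card A = (\<Sum>b \<in> {x \<in> hypergrid n d. x i = 1}. card (line_section n i A b))"
proof -
  let ?B = "{x \<in> hypergrid n d. x i = 1}"
  have "bij_betw (\<lambda>(b, u). b(i := u)) (Sigma ?B (line_section n i A)) A"
  proof (rule bij_betwI[where g = "\<lambda>x. (x(i := 1), x i)"])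
    show "(\<lambda>x. (x(i := 1), x i)) \<in> A \<rightarrow> Sigma ?B (line_section n i A)"
    proof
      fix x assume "x \<in> A"
      then have "x \<in> hypergrid n d" "x i \<in> {1..n}" using assms hypergrid_coord by auto
      then show "(x(i := 1), x i) \<in> Sigma ?B (line_section n i A)"
        using \<open>x \<in> A\<close> assms(1) by (auto simp: line_section_def intro!: hypergrid_upd)
    qed
  qed (auto simp: line_section_def fun_upd_idem)
  then have "card A = card (Sigma ?B (line_section n i A))"
    by (simp add: bij_betw_same_card)
  then show ?thesis by simp
qed

section \<open>Sorting sets direction by direction\<close>

definition dir_up :: "nat \<Rightarrow> nat \<Rightarrow> (nat \<Rightarrow> nat) set \<Rightarrow> bool" where
  "dir_up n i A \<longleftrightarrow> (\<forall>x \<in> A. \<forall>v. x i \<le> v \<longrightarrow> v \<le> n \<longrightarrow> x(i := v) \<in> A)"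

text \<open>This sorts the indicator function of \<open>A\<close> on every line in direction
  \<open>i\<close>: a line with \<open>k\<close> points of \<open>A\<close> keeps its top
  \<open>k\<close> positions, those above \<open>n - k\<close>.\<close>

definition dir_sort :: "nat \<Rightarrow> nat \<Rightarrow> nat \<Rightarrow> (nat \<Rightarrow> nat) set \<Rightarrow> (nat \<Rightarrow> nat) set" where
  "dir_sort n d i A = {x \<in> hypergrid n d. n < x i + card (line_section n i A x)}"

lemma dir_sort_subset: "dir_sort n d i A \<subseteq> hypergrid n d"
  by (auto simp: dir_sort_def)

lemma dir_up_dir_sort:
  assumes "i \<in> {1..d}"
  shows "dir_up n i (dir_sort n d i A)"
  unfolding dir_up_def dir_sort_def
  using assms hypergrid_upd[of _ n d i] hypergrid_coord[of _ n d i]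
  by (fastforce)

lemma dir_sort_idem:
  assumes i: "i \<in> {1..d}" and A: "A \<subseteq> hypergrid n d" "dir_up n i A"
  shows "dir_sort n d i A = A"
proof -
  have "x \<in> A \<longleftrightarrow> n < x i + card (line_section n i A x)" if x: "x \<in> hypergrid n d" for x
  proof
    assume "x \<in> A"
    then have "{x i..n} \<subseteq> line_section n i A x"
      using A(2) hypergrid_coord[OF x i] by (auto simp: line_section_def dir_up_def)
    then have "card {x i..n} \<le> card (line_section n i A x)" by (intro card_mono) auto
    then show "n < x i + card (line_section n i A x)" using hypergrid_coord[OF x i] by auto
  next
    assume *: "n < x i + card (line_section n i A x)"
    show "x \<in> A"
    proof (rule ccontr)
      assume "x \<notin> A"
      have "line_section n i A x \<subseteq> {x i<..n}"
      proof
        fix u assume u: "u \<in> line_section n i A x"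
        \<comment> \<open>Raising \<open>x(i := u)\<close> to height \<open>x i\<close> gives back
          \<open>x\<close>; it is written as an update to match \<open>dir_up\<close>.\<close>
        have "x(i := x i) \<in> A" if "u \<le> x i"
          using u A(2) that hypergrid_coord[OF x i]
          unfolding line_section_def dir_up_def by force
        then show "u \<in> {x i<..n}" using u \<open>x \<notin> A\<close> by (force simp: line_section_def)
      qed
      then have "card (line_section n i A x) \<le> card {x i<..n}" by (intro card_mono) auto
      then show False using * hypergrid_coord[OF x i] by auto
    qed
  qed
  then show ?thesis using A(1) by (auto simp: dir_sort_def)
qed

text \<open>Moving up in direction \<open>j\<close> embeds the section of \<open>A\<close> through
  the lower point into the section through the upper one, so the sorted upper line is filled at
  least as far down.\<close>

lemma dir_up_dir_sort_other:
  assumes "i \<in> {1..d}" "j \<in> {1..d}" "j \<noteq> i" "A \<subseteq> hypergrid n d" "dir_up n j A"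
  shows "dir_up n j (dir_sort n d i A)"
  unfolding dir_up_def
proof (intro ballI allI impI)
  fix x v assume x: "x \<in> dir_sort n d i A" and v: "x j \<le> v" "v \<le> n"
  then have xg: "x \<in> hypergrid n d" by (simp add: dir_sort_def)
  have "line_section n i A x \<subseteq> line_section n i A (x(j := v))"
  proof
    fix u assume "u \<in> line_section n i A x"
    then have u: "u \<in> {1..n}" "x(i := u) \<in> A" by (auto simp: line_section_def)
    then have "(x(i := u))(j := v) \<in> A" using assms v by (auto simp: dir_up_def)
    then show "u \<in> line_section n i A (x(j := v))"
      using u assms(3) by (simp add: line_section_def fun_upd_twist)
  qed
  then have "card (line_section n i A x) \<le> card (line_section n i A (x(j := v)))"
    by (intro card_mono) auto
  then show "x(j := v) \<in> dir_sort n d i A"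
    using x v assms hypergrid_upd[OF xg assms(2)] hypergrid_coord[OF xg assms(2)]
    by (auto simp: dir_sort_def)
qed

text \<open>On a single line the two sorted sections are nested top segments. They differ in as many
  points as the sizes of the original sections differ, which is at most the size of the symmetric
  difference of those sections.\<close>

lemma dir_sort_contraction:
  assumes i: "i \<in> {1..d}" and A: "A \<subseteq> hypergrid n d" and B: "B \<subseteq> hypergrid n d"
  shows "card (sym_diff (dir_sort n d i A) (dir_sort n d i B)) \<le> card (sym_diff A B)"
proof -
  let ?L = "line_section n i"
  have "card (?L (sym_diff (dir_sort n d i A) (dir_sort n d i B)) b) \<le> card (?L (sym_diff A B) b)"
    if b: "b \<in> hypergrid n d" for b
  proof -
    have "card (?L C b) \<le> card {1..n}" for C
      by (intro card_mono) (auto simp: line_section_def)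
    then have le: "card (?L A b) \<le> n" "card (?L B b) \<le> n" by auto
    have "?L (sym_diff (dir_sort n d i A) (dir_sort n d i B)) b =
        {u \<in> {1..n}. (n < u + card (?L A b)) \<noteq> (n < u + card (?L B b))}"
      using hypergrid_upd[OF b i] line_section_upd[of n i A b] line_section_upd[of n i B b]
      by (auto simp: dir_sort_def line_section_def)
    also have "\<dots> \<subseteq> {n - max (card (?L A b)) (card (?L B b)) <.. n - min (card (?L A b)) (card (?L B b))}"
      using le by (auto simp: max_def min_def split: if_splits)
    finally have "card (?L (sym_diff (dir_sort n d i A) (dir_sort n d i B)) b) \<le>
        card {n - max (card (?L A b)) (card (?L B b)) <.. n - min (card (?L A b)) (card (?L B b))}"
      by (intro card_mono) auto
    also have "\<dots> \<le> card (sym_diff (?L A b) (?L B b))"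
    proof -
      have "card (?L A b) \<le> card (?L B b \<union> sym_diff (?L A b) (?L B b))"
        "card (?L B b) \<le> card (?L A b \<union> sym_diff (?L A b) (?L B b))"
        by (intro card_mono; auto)+
      then show ?thesis
        using le card_Un_le[of "?L B b" "sym_diff (?L A b) (?L B b)"]
          card_Un_le[of "?L A b" "sym_diff (?L A b) (?L B b)"]
        by (simp add: max_def min_def) linarith
    qed
    also have "sym_diff (?L A b) (?L B b) = ?L (sym_diff A B) b"
      by (auto simp: line_section_def)
    finally show ?thesis .
  qed
  moreover have "sym_diff (dir_sort n d i A) (dir_sort n d i B) \<subseteq> hypergrid n d"
    using dir_sort_subset by fast
  moreover have "sym_diff A B \<subseteq> hypergrid n d" using A B by fast
  ultimately show ?thesis
    by (simp add: card_by_lines[OF i], intro sum_mono) simp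
qed

lemma card_sym_diff_triangle:
  assumes "finite A" "finite B" "finite C"
  shows "card (sym_diff A C) \<le> card (sym_diff A B) + card (sym_diff B C)"
proof -
  have "card (sym_diff A C) \<le> card (sym_diff A B \<union> sym_diff B C)"
    using assms by (intro card_mono) auto
  also have "\<dots> \<le> card (sym_diff A B) + card (sym_diff B C)" by (rule card_Un_le)
  finally show ?thesis .
qed

text \<open>The directions are sorted in turn. The invariant keeps, for every direction
  \<open>k\<close> still to come, some set closed upwards in direction \<open>k\<close> that is as
  near to the current set as \<open>T k\<close> was to \<open>A\<close>. Sorting this companion
  together with the current set preserves both properties.\<close>

lemma sort_all_directions:
  assumes A: "A \<subseteq> hypergrid n d"
    and T: "\<And>i. i \<in> {1..d} \<Longrightarrow> T i \<subseteq> hypergrid n d" "\<And>i. i \<in> {1..d} \<Longrightarrow> dir_up n i (T i)"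
  obtains S where "S \<subseteq> hypergrid n d" "\<And>i. i \<in> {1..d} \<Longrightarrow> dir_up n i S"
    "card (sym_diff A S) \<le> 2 * (\<Sum>i\<in>{1..d}. card (sym_diff A (T i)))"
proof -
  have fin: "finite B" if "B \<subseteq> hypergrid n d" for B :: "(nat \<Rightarrow> nat) set"
    using that finite_hypergrid by (rule finite_subset)
  have "\<exists>S \<subseteq> hypergrid n d. (\<forall>i\<in>{1..j}. dir_up n i S) \<and>
      card (sym_diff A S) \<le> 2 * (\<Sum>i\<in>{1..j}. card (sym_diff A (T i))) \<and>
      (\<forall>k\<in>{j<..d}. \<exists>R \<subseteq> hypergrid n d. dir_up n k R \<and> card (sym_diff S R) \<le> card (sym_diff A (T k)))"
    if "j \<le> d" for j
    using that
  proof (induction j)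
    case 0
    show ?case
    proof (rule exI[of _ A], intro conjI ballI A)
      fix k assume "k \<in> {0<..d}"
      then show "\<exists>R \<subseteq> hypergrid n d. dir_up n k R \<and> card (sym_diff A R) \<le> card (sym_diff A (T k))"
        using T by (intro exI[of _ "T k"]) auto
    qed auto
  next
    case (Suc j)
    then have "j \<le> d" by simp
    from Suc.IH[OF this] obtain S where S: "S \<subseteq> hypergrid n d" "\<And>i. i \<in> {1..j} \<Longrightarrow> dir_up n i S"
      "card (sym_diff A S) \<le> 2 * (\<Sum>i\<in>{1..j}. card (sym_diff A (T i)))"
      and R: "\<And>k. k \<in> {j<..d} \<Longrightarrow>
        \<exists>R \<subseteq> hypergrid n d. dir_up n k R \<and> card (sym_diff S R) \<le> card (sym_diff A (T k))"
      by blast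
    define S' where "S' = dir_sort n d (Suc j) S"
    have i: "Suc j \<in> {1..d}" using Suc.prems by auto
    have S': "S' \<subseteq> hypergrid n d" by (simp add: S'_def dir_sort_subset)
    obtain Q where Q: "Q \<subseteq> hypergrid n d" "dir_up n (Suc j) Q"
      "card (sym_diff S Q) \<le> card (sym_diff A (T (Suc j)))"
      using R[of "Suc j"] Suc.prems by auto
    \<comment> \<open>Sorting fixes \<open>Q\<close>, so by contraction \<open>S'\<close> is no
      farther from \<open>Q\<close> than \<open>S\<close> is. This detour through \<open>Q\<close>
      is the source of the factor 2.\<close>
    have "card (sym_diff S S') \<le> card (sym_diff S Q) + card (sym_diff Q S')"
      using S Q S' fin by (intro card_sym_diff_triangle) auto
    also have "card (sym_diff Q S') \<le> card (sym_diff Q S)"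
      using dir_sort_contraction[OF i Q(1) S(1)] dir_sort_idem[OF i Q(1,2)] by (simp add: S'_def)
    also have "sym_diff Q S = sym_diff S Q" by auto
    finally have "card (sym_diff S S') \<le> 2 * card (sym_diff A (T (Suc j)))" using Q(3) by simp
    moreover have "card (sym_diff A S') \<le> card (sym_diff A S) + card (sym_diff S S')"
      using A S S' fin by (intro card_sym_diff_triangle) auto
    ultimately have "card (sym_diff A S') \<le> 2 * (\<Sum>i\<in>{1..Suc j}. card (sym_diff A (T i)))"
      using S(3) by simp
    moreover have "dir_up n k S'" if "k \<in> {1..Suc j}" for k
    proof (cases "k = Suc j")
      case True
      then show ?thesis using dir_up_dir_sort[OF i] by (simp add: S'_def)
    next
      case False
      then show ?thesis using that S i Suc.prems unfolding S'_def
        by (intro dir_up_dir_sort_other) auto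
    qed
    moreover have "\<exists>R \<subseteq> hypergrid n d. dir_up n k R \<and> card (sym_diff S' R) \<le> card (sym_diff A (T k))"
      if k: "k \<in> {Suc j<..d}" for k
    proof -
      obtain Q where Q: "Q \<subseteq> hypergrid n d" "dir_up n k Q"
        "card (sym_diff S Q) \<le> card (sym_diff A (T k))"
        using R[of k] k by auto
      have "dir_up n k (dir_sort n d (Suc j) Q)"
        using k i Q by (intro dir_up_dir_sort_other) auto
      moreover have "card (sym_diff S' (dir_sort n d (Suc j) Q)) \<le> card (sym_diff A (T k))"
        using dir_sort_contraction[OF i S(1) Q(1)] Q(3) by (simp add: S'_def)
      ultimately show ?thesis using dir_sort_subset by meson
    qed
    ultimately show ?case using S' by - (rule exI[of _ S'], intro conjI ballI; simp)
  qed
  from this[of d] show thesis using that by auto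
qed

text \<open>The coordinates of \<open>x\<close> are replaced by those of \<open>y\<close> one at a
  time, each step being an upward move along a line.\<close>

lemma dir_up_imp_upset:
  assumes A: "A \<subseteq> hypergrid n d" and up: "\<And>i. i \<in> {1..d} \<Longrightarrow> dir_up n i A"
    and x: "x \<in> A" and y: "y \<in> hypergrid n d" and le: "grid_le d x y"
  shows "y \<in> A"
proof -
  have "(\<lambda>k. if k \<in> {1..j} then y k else x k) \<in> A" if "j \<le> d" for j
    using that
  proof (induction j)
    case (Suc j)
    let ?z = "\<lambda>k. if k \<in> {1..j} then y k else x k"
    have "?z (Suc j) \<le> y (Suc j)" "y (Suc j) \<le> n"
      using le y Suc.prems hypergrid_coord[OF y, of "Suc j"] by (auto simp: grid_le_def)
    then have "?z(Suc j := y (Suc j)) \<in> A"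
      using up[of "Suc j"] Suc by (auto simp: dir_up_def)
    also have "?z(Suc j := y (Suc j)) = (\<lambda>k. if k \<in> {1..Suc j} then y k else x k)"
      by (auto simp: fun_eq_iff)
    finally show ?case .
  qed (use x in simp)
  from this[of d] have "(\<lambda>k. if k \<in> {1..d} then y k else x k) \<in> A" by simp
  \<comment> \<open>Outside \<open>{1..d}\<close> both functions are \<open>undefined\<close> by
    extensionality.\<close>
  also have "(\<lambda>k. if k \<in> {1..d} then y k else x k) = y"
  proof
    fix k
    have "x \<in> hypergrid n d" using x A by blast
    then show "(if k \<in> {1..d} then y k else x k) = y k"
      using y by (auto simp: hypergrid_def PiE_iff extensional_def)
  qed
  finally show ?thesis .
qed


section \<open>Distance to monotonicity from deletions along lines\<close>

text \<open>Let \<open>T i\<close> be the upward closure of \<open>G - W i\<close> in direction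
  \<open>i\<close>. A point of \<open>G\<close> missing from \<open>T i\<close> lies in
  \<open>W i\<close>. A point of \<open>T i\<close> outside \<open>G\<close> is the upper end of a
  violating pair whose lower end is not in \<open>W i\<close>, so it lies in \<open>W i\<close>
  itself. Sorting all directions then costs the factor 2.\<close>

lemma upset_near_covered_set:
  assumes G: "G \<subseteq> hypergrid n d" and W: "\<And>i. i \<in> {1..d} \<Longrightarrow> finite (W i)"
    and cover: "\<And>i x v. i \<in> {1..d} \<Longrightarrow> x \<in> G \<Longrightarrow> v \<in> {1..n} \<Longrightarrow> x i < v \<Longrightarrow> x(i := v) \<notin> G \<Longrightarrow>
      x \<in> W i \<or> x(i := v) \<in> W i"
  shows "\<exists>S \<subseteq> hypergrid n d. (\<forall>x\<in>S. \<forall>y\<in>hypergrid n d. grid_le d x y \<longrightarrow> y \<in> S) \<and>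
    card (sym_diff G S) \<le> 2 * (\<Sum>i\<in>{1..d}. card (W i))"
proof -
  define T where "T i = {y \<in> hypergrid n d. \<exists>x \<in> G - W i. \<exists>v \<ge> x i. y = x(i := v)}" for i
  have T: "T i \<subseteq> hypergrid n d" for i by (auto simp: T_def)
  have up: "dir_up n i (T i)" if i: "i \<in> {1..d}" for i
    unfolding dir_up_def
  proof (intro ballI allI impI)
    fix y v assume y: "y \<in> T i" and v: "y i \<le> v" "v \<le> n"
    obtain x u where x: "x \<in> G - W i" "u \<ge> x i" "y = x(i := u)" and yg: "y \<in> hypergrid n d"
      using y by (auto simp: T_def)
    have "y(i := v) \<in> hypergrid n d"
      using hypergrid_upd[OF yg i, of v] hypergrid_coord[OF yg i] v by auto
    moreover have "y(i := v) = x(i := v)" "x i \<le> v" using x v by auto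
    ultimately show "y(i := v) \<in> T i" using x(1) unfolding T_def by blast
  qed
  have "sym_diff G (T i) \<subseteq> W i" if i: "i \<in> {1..d}" for i
  proof
    fix y assume "y \<in> sym_diff G (T i)"
    then consider "y \<in> G" "y \<notin> T i" | "y \<in> T i" "y \<notin> G" by blast
    then show "y \<in> W i"
    proof cases
      case 1
      then have "y = y(i := y i)" "y \<in> hypergrid n d" using G by auto
      then show ?thesis using 1 unfolding T_def by blast
    next
      case 2
      then obtain x v where x: "x \<in> G" "x \<notin> W i" "v \<ge> x i" "y = x(i := v)" and y: "y \<in> hypergrid n d"
        by (auto simp: T_def)
      then have "x i \<noteq> v" using 2(2) by auto
      moreover have "v \<in> {1..n}" using hypergrid_coord[OF y i] x(4) by simp
      ultimately show ?thesis using cover[OF i x(1), of v] x 2(2) by auto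
    qed
  qed
  then have "(\<Sum>i\<in>{1..d}. card (sym_diff G (T i))) \<le> (\<Sum>i\<in>{1..d}. card (W i))"
    using W by (intro sum_mono card_mono) auto
  moreover obtain S where S: "S \<subseteq> hypergrid n d" "\<And>i. i \<in> {1..d} \<Longrightarrow> dir_up n i S"
    "card (sym_diff G S) \<le> 2 * (\<Sum>i\<in>{1..d}. card (sym_diff G (T i)))"
    using sort_all_directions[OF G T up] by blast
  ultimately have "card (sym_diff G S) \<le> 2 * (\<Sum>i\<in>{1..d}. card (W i))" by linarith
  moreover have "\<forall>x\<in>S. \<forall>y\<in>hypergrid n d. grid_le d x y \<longrightarrow> y \<in> S"
    using dir_up_imp_upset[OF S(1,2)] by blast
  ultimately show ?thesis using S(1) by blast
qed

lemma card_eq_sum_fibres: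
  assumes "finite A" "finite C" "h ` A \<subseteq> C"
  shows "card A = (\<Sum>c\<in>C. card {x \<in> A. h x = c})"
  using sum.group[OF assms, of "\<lambda>_. 1 :: nat"] by simp

lemma grid_le_upd: "x i \<le> v \<Longrightarrow> grid_le d x (x(i := v))"
  by (simp add: grid_le_def)

lemma grid_le_trans: "grid_le d x y \<Longrightarrow> grid_le d y z \<Longrightarrow> grid_le d x z"
  unfolding grid_le_def by (meson order_trans)

lemma dimension_reduction:
  fixes f :: "(nat \<Rightarrow> nat) \<Rightarrow> int"
  assumes V: "\<And>i. i \<in> {1..d} \<Longrightarrow> V i \<subseteq> hypergrid n d"
    and cover: "\<And>i x v. i \<in> {1..d} \<Longrightarrow> x \<in> hypergrid n d \<Longrightarrow> v \<in> {1..n} \<Longrightarrow> x i < v \<Longrightarrow>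
      f (x(i := v)) < f x \<Longrightarrow> x \<in> V i \<or> x(i := v) \<in> V i"
  shows "\<exists>h :: (nat \<Rightarrow> nat) \<Rightarrow> int. monotone_on (hypergrid n d) (grid_le d) (\<le>) h \<and>
    card {x \<in> hypergrid n d. f x \<noteq> h x} \<le> 4 * (\<Sum>i\<in>{1..d}. card (V i))"
proof -
  let ?D = "hypergrid n d"
  obtain h :: "(nat \<Rightarrow> nat) \<Rightarrow> int" where h: "monotone_on ?D (grid_le d) (\<le>) h"
    and raise: "\<And>c U. U \<subseteq> {x \<in> ?D. h x = c} \<Longrightarrow> (\<And>x y. x \<in> U \<Longrightarrow> y \<in> ?D \<Longrightarrow> h y = c \<Longrightarrow> grid_le d x y \<Longrightarrow> y \<in> U) \<Longrightarrow>
           card {x \<in> U. f x > c} \<le> card {x \<in> U. f x \<le> c}"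
    and lower: "\<And>c U. U \<subseteq> {x \<in> ?D. h x = c} \<Longrightarrow> (\<And>x y. x \<in> U \<Longrightarrow> y \<in> ?D \<Longrightarrow> h y = c \<Longrightarrow> grid_le d y x \<Longrightarrow> y \<in> U) \<Longrightarrow>
           card {x \<in> U. f x < c} \<le> card {x \<in> U. f x \<ge> c}"
  proof (rule median_regression[where D = ?D and le = "grid_le d" and f = f], goal_cases)
    case (2 x y z)
    from 2(2,3) show ?case by (rule grid_le_trans)
  next
    case (3 h)
    show thesis by (rule 3(1)[OF 3(2-4)])
  qed (rule finite_hypergrid)
  have mono: "h x \<le> h (x(i := v))" if "i \<in> {1..d}" "x \<in> ?D" "v \<in> {1..n}" "x i < v" for i x v
    using monotone_onD[OF h, of x "x(i := v)"] that hypergrid_upd grid_le_upd[of x i v d] by auto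
  define W where "W c i = {x \<in> V i. h x = c}" for c i
  have finW: "finite (W c i)" if "i \<in> {1..d}" for c i
    using finite_subset[OF V[OF that] finite_hypergrid] by (simp add: W_def)
  \<comment> \<open>\<open>?G\<close> is an upset up to violations inside the level set \<open>c\<close>, so the deletions there suffice.\<close>
  have above: "card {x \<in> ?D. h x = c \<and> f x > c} \<le> 2 * (\<Sum>i\<in>{1..d}. card (W c i))" for c
  proof -
    let ?G = "{x \<in> ?D. h x > c \<or> h x = c \<and> f x > c}"
    have "\<exists>S \<subseteq> ?D. (\<forall>x\<in>S. \<forall>y\<in>?D. grid_le d x y \<longrightarrow> y \<in> S) \<and>
      card (sym_diff ?G S) \<le> 2 * (\<Sum>i\<in>{1..d}. card (W c i))"
    proof (rule upset_near_covered_set[of ?G n d "W c"])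
      fix i x v assume *: "i \<in> {1..d}" "x \<in> ?G" "v \<in> {1..n}" "x i < v" "x(i := v) \<notin> ?G"
      then have x: "x \<in> ?D" by simp
      then have "x(i := v) \<in> ?D" using * hypergrid_upd by simp
      \<comment> \<open>The lower end in \<open>?G\<close> has \<open>h x\<close> at least
        \<open>c\<close>, the upper end outside \<open>?G\<close> has value at most
        \<open>c\<close>, and monotonicity of \<open>h\<close> pinches both to
        \<open>c\<close>.\<close>
      then have "h x = c" "h (x(i := v)) = c" "f (x(i := v)) < f x"
        using *(2,5) mono[OF *(1) x *(3,4)] by auto
      then show "x \<in> W c i \<or> x(i := v) \<in> W c i"
        using cover[OF *(1) x *(3,4)] by (auto simp: W_def)
    qed (use finW in auto)
    then obtain S where S: "S \<subseteq> ?D" "\<forall>x\<in>S. \<forall>y\<in>?D. grid_le d x y \<longrightarrow> y \<in> S"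
      "card (sym_diff ?G S) \<le> 2 * (\<Sum>i\<in>{1..d}. card (W c i))" by blast
    let ?U = "{x \<in> S. h x = c}"
    have U: "card {x \<in> ?U. f x > c} \<le> card {x \<in> ?U. f x \<le> c}"
      by (rule raise) (use S in auto)
    have finS: "finite S" using S(1) finite_hypergrid by (rule finite_subset)
    \<comment> \<open>Inside \<open>S\<close>, the points with \<open>f x > c\<close> are traded by
      \<open>raise\<close> for points with \<open>f x \<le> c\<close>. The latter lie in
      \<open>S\<close> but not in \<open>?G\<close>, the points left outside \<open>S\<close> lie in
      \<open>?G\<close>, so all are counted by the symmetric difference.\<close>
    have "{x \<in> ?D. h x = c \<and> f x > c} = {x \<in> ?D - S. h x = c \<and> f x > c} \<union> {x \<in> ?U. f x > c}"
      using S(1) by auto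
    also have "card \<dots> \<le> card {x \<in> ?D - S. h x = c \<and> f x > c} + card {x \<in> ?U. f x > c}"
      by (rule card_Un_le)
    also have "\<dots> \<le> card {x \<in> ?D - S. h x = c \<and> f x > c} + card {x \<in> ?U. f x \<le> c}"
      using U by simp
    also have "\<dots> = card ({x \<in> ?D - S. h x = c \<and> f x > c} \<union> {x \<in> ?U. f x \<le> c})"
      using finS by (intro card_Un_disjoint[symmetric]) auto
    also have "\<dots> \<le> card (sym_diff ?G S)"
      using finS by (intro card_mono) auto
    finally show ?thesis using S(3) by simp
  qed
  have below: "card {x \<in> ?D. h x = c \<and> f x < c} \<le> 2 * (\<Sum>i\<in>{1..d}. card (W c i))" for c
  proof -
    \<comment> \<open>The dual argument: points with \<open>f x < c\<close> must now fall outside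
      \<open>?G\<close>, and the complement of the upset \<open>S\<close> is down-closed, as
      \<open>lower\<close> requires.\<close>
    let ?G = "{x \<in> ?D. h x > c \<or> h x = c \<and> f x \<ge> c}"
    have "\<exists>S \<subseteq> ?D. (\<forall>x\<in>S. \<forall>y\<in>?D. grid_le d x y \<longrightarrow> y \<in> S) \<and>
      card (sym_diff ?G S) \<le> 2 * (\<Sum>i\<in>{1..d}. card (W c i))"
    proof (rule upset_near_covered_set[of ?G n d "W c"])
      fix i x v assume *: "i \<in> {1..d}" "x \<in> ?G" "v \<in> {1..n}" "x i < v" "x(i := v) \<notin> ?G"
      then have x: "x \<in> ?D" by simp
      then have "x(i := v) \<in> ?D" using * hypergrid_upd by simp
      then have "h x = c" "h (x(i := v)) = c" "f (x(i := v)) < f x"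
        using *(2,5) mono[OF *(1) x *(3,4)] by auto
      then show "x \<in> W c i \<or> x(i := v) \<in> W c i"
        using cover[OF *(1) x *(3,4)] by (auto simp: W_def)
    qed (use finW in auto)
    then obtain S where S: "S \<subseteq> ?D" "\<forall>x\<in>S. \<forall>y\<in>?D. grid_le d x y \<longrightarrow> y \<in> S"
      "card (sym_diff ?G S) \<le> 2 * (\<Sum>i\<in>{1..d}. card (W c i))" by blast
    let ?U = "{x \<in> ?D - S. h x = c}"
    have U: "card {x \<in> ?U. f x < c} \<le> card {x \<in> ?U. f x \<ge> c}"
      by (rule lower) (use S in auto)
    have finS: "finite S" using S(1) finite_hypergrid by (rule finite_subset)
    have "{x \<in> ?D. h x = c \<and> f x < c} = {x \<in> S. h x = c \<and> f x < c} \<union> {x \<in> ?U. f x < c}"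
      using S(1) by auto
    also have "card \<dots> \<le> card {x \<in> S. h x = c \<and> f x < c} + card {x \<in> ?U. f x < c}"
      by (rule card_Un_le)
    also have "\<dots> \<le> card {x \<in> S. h x = c \<and> f x < c} + card {x \<in> ?U. f x \<ge> c}"
      using U by simp
    also have "\<dots> = card ({x \<in> S. h x = c \<and> f x < c} \<union> {x \<in> ?U. f x \<ge> c})"
      using finS by (intro card_Un_disjoint[symmetric]) auto
    also have "\<dots> \<le> card (sym_diff ?G S)"
      using finS by (intro card_mono) auto
    finally show ?thesis using S(3) by simp
  qed
  have "card {x \<in> ?D. f x \<noteq> h x} = (\<Sum>c\<in>h ` ?D. card {x \<in> {x \<in> ?D. f x \<noteq> h x}. h x = c})"
    by (rule card_eq_sum_fibres) auto
  also have "\<dots> \<le> (\<Sum>c\<in>h ` ?D. 4 * (\<Sum>i\<in>{1..d}. card (W c i)))"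
  proof (rule sum_mono)
    fix c
    have "{x \<in> {x \<in> ?D. f x \<noteq> h x}. h x = c} =
      {x \<in> ?D. h x = c \<and> f x > c} \<union> {x \<in> ?D. h x = c \<and> f x < c}" by auto
    also have "card \<dots> \<le> card {x \<in> ?D. h x = c \<and> f x > c} + card {x \<in> ?D. h x = c \<and> f x < c}"
      by (rule card_Un_le)
    finally show "card {x \<in> {x \<in> ?D. f x \<noteq> h x}. h x = c} \<le> 4 * (\<Sum>i\<in>{1..d}. card (W c i))"
      using above[of c] below[of c] by linarith
  qed
  also have "\<dots> = 4 * (\<Sum>i\<in>{1..d}. \<Sum>c\<in>h ` ?D. card (W c i))"
    unfolding sum_distrib_left[symmetric] by (subst sum.swap) (rule refl)
  also have "(\<Sum>i\<in>{1..d}. \<Sum>c\<in>h ` ?D. card (W c i)) = (\<Sum>i\<in>{1..d}. card (V i))"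
    using V finite_subset[OF V finite_hypergrid]
    by (intro sum.cong refl) (auto simp: W_def intro!: card_eq_sum_fibres[symmetric])
  finally show ?thesis using h by blast
qed

section \<open>Erased points and the weight of violations on a line\<close>

text \<open>A greedy cover from the left: the interval that starts at the least point of
  \<open>B\<close> covers \<open>B\<close> up to \<open>y\<close> and has fewer than twice as many
  points as it has elements of \<open>E\<close>. The remaining points of \<open>B\<close> use only
  elements of \<open>E\<close> above \<open>y\<close>, so no element of \<open>E\<close> is charged
  twice.\<close>

lemma rising_sun:
  fixes B E :: "nat set"
  assumes "finite B" "finite E"
    and "\<And>x. x \<in> B \<Longrightarrow> \<exists>y\<ge>x. y - x + 1 < 2 * card (E \<inter> {x..y})"
  shows "card B \<le> 2 * card E"
  using assms
proof (induction "card B" arbitrary: B E rule: less_induct)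
  case less
  show ?case
  proof (cases "B = {}")
    case False
    define x where "x = Min B"
    have x: "x \<in> B" "\<And>b. b \<in> B \<Longrightarrow> x \<le> b" using less.prems(1) False by (auto simp: x_def)
    then obtain y where y: "y \<ge> x" "y - x + 1 < 2 * card (E \<inter> {x..y})" using less.prems(3) by blast
    define B' E' where "B' = {b \<in> B. y < b}" and "E' = {e \<in> E. y < e}"
    have "x \<in> B - B'" "B' \<subseteq> B" using x(1) y(1) by (auto simp: B'_def)
    then have "card B' < card B"
      using less.prems(1) by (intro psubset_card_mono) auto
    moreover have "\<exists>z\<ge>b. z - b + 1 < 2 * card (E' \<inter> {b..z})" if "b \<in> B'" for b
    proof -
      have "b \<in> B" using that by (simp add: B'_def)
      then obtain z where "z \<ge> b" "z - b + 1 < 2 * card (E \<inter> {b..z})"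
        using less.prems(3) by blast
      moreover have "E' \<inter> {b..z} = E \<inter> {b..z}" using that by (auto simp: B'_def E'_def)
      ultimately show ?thesis by auto
    qed
    ultimately have IH: "card B' \<le> 2 * card E'"
      using less.hyps[of B' E'] less.prems by (auto simp: B'_def E'_def)
    have "card B \<le> card ({x..y} \<union> B')"
      using x less.prems(1) by (intro card_mono) (auto simp: B'_def not_less)
    also have "\<dots> \<le> card {x..y} + card B'" by (rule card_Un_le)
    also have "\<dots> \<le> 2 * (card (E \<inter> {x..y}) + card E')" using y IH by simp
    also have "card (E \<inter> {x..y}) + card E' = card ((E \<inter> {x..y}) \<union> E')"
      using less.prems(2) by (intro card_Un_disjoint[symmetric]) (auto simp: E'_def)
    also have "\<dots> \<le> card E" using less.prems(2) by (intro card_mono) (auto simp: E'_def)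
    finally show ?thesis by simp
  qed simp
qed

definition sparse :: "nat \<Rightarrow> nat \<Rightarrow> nat \<Rightarrow> (nat \<Rightarrow> nat) set \<Rightarrow> (nat \<Rightarrow> nat) set" where
  "sparse n d i E = {x \<in> hypergrid n d.
     \<exists>v\<in>{x i..n}. v - x i + 1 < 2 * card (line_section n i E x \<inter> {x i..v})}"

lemma card_sparse:
  assumes i: "i \<in> {1..d}" and E: "E \<subseteq> hypergrid n d"
  shows "card (sparse n d i E) \<le> 2 * card E"
proof -
  have "card (line_section n i (sparse n d i E) b) \<le> 2 * card (line_section n i E b)" for b
  proof (rule rising_sun)
    fix u assume "u \<in> line_section n i (sparse n d i E) b"
    then have "b(i := u) \<in> sparse n d i E" by (simp add: line_section_def)
    then show "\<exists>v\<ge>u. v - u + 1 < 2 * card (line_section n i E b \<inter> {u..v})"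
      by (auto simp: sparse_def)
  qed auto
  moreover have "sparse n d i E \<subseteq> hypergrid n d" by (auto simp: sparse_def)
  ultimately show ?thesis
    using E by (simp add: card_by_lines[OF i] sum_distrib_left sum_mono)
qed

text \<open>The summand \<open>1\<close> in the denominator keeps the weight of a degenerate sample (\<open>u = v\<close>)
  positive; such a sample never violates.\<close>

definition wt :: "nat \<Rightarrow> nat \<Rightarrow> real" where
  "wt u v = 1 / (1 + \<bar>real u - real v\<bar>)"

lemma wt_pos: "0 < wt u v"
  by (simp add: wt_def add_pos_nonneg)

definition violates :: "nat \<Rightarrow> nat \<Rightarrow> real option \<Rightarrow> real option \<Rightarrow> bool" where
  "violates u v a b \<longleftrightarrow> (\<exists>r s. a = Some r \<and> b = Some s \<and> (u < v \<and> s < r \<or> v < u \<and> r < s))"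

definition violated :: "((nat \<Rightarrow> nat) \<Rightarrow> real option) \<Rightarrow> nat \<Rightarrow> (nat \<Rightarrow> nat) \<Rightarrow> nat \<Rightarrow> bool" where
  "violated f i x v \<longleftrightarrow> violates (x i) v (f x) (f (x(i := v)))"

text \<open>Up to normalisation, the probability of drawing a violated sample with direction
  \<open>i\<close> and point \<open>x\<close>.\<close>

definition load :: "nat \<Rightarrow> ((nat \<Rightarrow> nat) \<Rightarrow> real option) \<Rightarrow> nat \<Rightarrow> (nat \<Rightarrow> nat) \<Rightarrow> real" where
  "load n f i x = (\<Sum>v | v \<in> {1..n} \<and> violated f i x v. wt (x i) v)"

text \<open>Points of \<open>{a..b}\<close> are at distance at most \<open>b - a\<close>, so each
  violated pair weighs at least \<open>1 / (b - a + 1)\<close>.\<close>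

lemma load_ge:
  assumes "P \<subseteq> {1..n}" "P \<subseteq> {a..b}" "x i \<in> {a..b}" "\<And>v. v \<in> P \<Longrightarrow> violated f i x v"
  shows "real (card P) / real (b - a + 1) \<le> load n f i x"
proof -
  have "real (card P) / real (b - a + 1) = (\<Sum>v\<in>P. 1 / (1 + real (b - a)))" by (simp add: add.commute)
  also have "\<dots> \<le> (\<Sum>v\<in>P. wt (x i) v)"
  proof (rule sum_mono)
    fix v assume "v \<in> P"
    then have "v \<in> {a..b}" using assms by blast
    then have "\<bar>real (x i) - real v\<bar> \<le> real (b - a)" using assms(3) by auto
    then show "1 / (1 + real (b - a)) \<le> wt (x i) v"
      unfolding wt_def by (intro divide_left_mono mult_pos_pos) auto
  qed
  also have "\<dots> \<le> load n f i x"
    unfolding load_def using assms wt_pos by (intro sum_mono2) (auto intro: less_imp_le)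
  finally show ?thesis .
qed

text \<open>Since \<open>s < r\<close>, no value \<open>t\<close> satisfies both
  \<open>r \<le> t\<close> and \<open>t \<le> s\<close>, so every nonerased point of the interval is
  in violation with one of the two ends. At most half of the \<open>m\<close> points are erased,
  hence \<open>P\<close> or \<open>Q\<close> has at least \<open>m / 4\<close> elements, each of
  weight at least \<open>1 / m\<close>.\<close>

lemma violation_cover:
  assumes i: "i \<in> {1..d}" and x: "x \<in> hypergrid n d" and v: "v \<in> {1..n}" "x i < v"
    and f: "f x = Some r" "f (x(i := v)) = Some s" "s < r"
    and dense: "x \<notin> sparse n d i {x \<in> hypergrid n d. f x = None}"
  shows "1/4 \<le> load n f i x \<or> 1/4 \<le> load n f i (x(i := v))"
proof -
  let ?y = "x(i := v)" and ?E = "{x \<in> hypergrid n d. f x = None}"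
  define m where "m = v - x i + 1"
  have xi: "1 \<le> x i" using hypergrid_coord[OF x i] by simp
  define P Q where "P = {u \<in> {x i..v}. violated f i x u}" and "Q = {u \<in> {x i..v}. violated f i ?y u}"
  have "{x i..v} \<subseteq> (line_section n i ?E x \<inter> {x i..v}) \<union> (P \<union> Q)"
  proof
    fix u assume u: "u \<in> {x i..v}"
    show "u \<in> (line_section n i ?E x \<inter> {x i..v}) \<union> (P \<union> Q)"
    proof (cases "f (x(i := u))")
      case None
      then show ?thesis using u v xi hypergrid_upd[OF x i, of u] by (auto simp: line_section_def)
    next
      case (Some t)
      have "u \<noteq> x i \<longrightarrow> u \<noteq> v \<longrightarrow> t < r \<or> s < t" using f(3) by auto
      \<comment> \<open>The ends violate each other: \<open>x i\<close> belongs to \<open>Q\<close>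
        and \<open>v\<close> to \<open>P\<close>.\<close>
      then show ?thesis using u v f Some
        by (cases "u = x i"; cases "u = v") (auto simp: P_def Q_def violated_def violates_def fun_upd_idem)
    qed
  qed
  then have "card {x i..v} \<le> card ((line_section n i ?E x \<inter> {x i..v}) \<union> (P \<union> Q))"
    by (intro card_mono) (auto simp: P_def Q_def)
  also have "\<dots> \<le> card (line_section n i ?E x \<inter> {x i..v}) + (card P + card Q)"
    by (intro order.trans[OF card_Un_le] add_left_mono card_Un_le)
  finally have "m \<le> card (line_section n i ?E x \<inter> {x i..v}) + (card P + card Q)"
    using v by (simp add: m_def)
  moreover have "2 * card (line_section n i ?E x \<inter> {x i..v}) \<le> m"
    using dense x v by (auto simp: sparse_def m_def not_less)
  ultimately have "m \<le> 4 * card P \<or> m \<le> 4 * card Q" by linarith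
  moreover have "card P / m \<le> load n f i x"
    unfolding m_def using v xi by (intro load_ge) (auto simp: P_def)
  moreover have "card Q / m \<le> load n f i ?y"
    unfolding m_def using v xi by (intro load_ge) (auto simp: Q_def)
  moreover have "1/4 \<le> real c / m" if "m \<le> 4 * c" for c
    using that by (simp add: m_def field_simps)
  ultimately show ?thesis by (meson order_trans)
qed

text \<open>Markov's inequality with threshold 1/4.\<close>

lemma card_heavy:
  assumes "finite D"
  shows "card {x \<in> D. 1/4 \<le> load n f i x} \<le> 4 * (\<Sum>x\<in>D. load n f i x)"
proof -
  have nonneg: "0 \<le> load n f i x" for x
    unfolding load_def by (intro sum_nonneg) (auto intro: less_imp_le wt_pos)
  have "card {x \<in> D. 1/4 \<le> load n f i x} / 4 = (\<Sum>x | x \<in> D \<and> 1/4 \<le> load n f i x. 1/4)" by simp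
  also have "\<dots> \<le> (\<Sum>x | x \<in> D \<and> 1/4 \<le> load n f i x. load n f i x)" by (intro sum_mono) auto
  also have "\<dots> \<le> (\<Sum>x\<in>D. load n f i x)" using assms nonneg by (intro sum_mono2) auto
  finally show ?thesis by simp
qed


section \<open>Weighted sampling and the pair tester\<close>

definition weighted_pmf :: "'a set \<Rightarrow> ('a \<Rightarrow> real) \<Rightarrow> 'a pmf" where
  "weighted_pmf S w = embed_pmf (\<lambda>s. if s \<in> S then w s / sum w S else 0)"

lemma
  assumes S: "finite S" "S \<noteq> {}" and w: "\<And>s. s \<in> S \<Longrightarrow> 0 < w s"
  shows set_weighted_pmf: "set_pmf (weighted_pmf S w) = S"
    and prob_weighted_pmf:
      "measure_pmf.prob (weighted_pmf S w) {s. P s} = (\<Sum>s | s \<in> S \<and> P s. w s) / sum w S"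
proof -
  define Z where "Z = sum w S"
  have Z: "0 < Z" unfolding Z_def using S w by (intro sum_pos) auto
  let ?p = "weighted_pmf S w"
  have p: "pmf ?p s = (if s \<in> S then w s / Z else 0)" for s
    unfolding weighted_pmf_def Z_def[symmetric]
  proof (rule pmf_embed_pmf)
    show "0 \<le> (if s \<in> S then w s / Z else 0)" for s
      using w Z by (auto intro: less_imp_le)
    have "(\<integral>\<^sup>+ s. ennreal (if s \<in> S then w s / Z else 0) \<partial>count_space UNIV) =
      (\<Sum>s\<in>S. ennreal (if s \<in> S then w s / Z else 0))"
      using S(1) by (intro nn_integral_count_space') auto
    also have "\<dots> = ennreal (\<Sum>s\<in>S. w s / Z)"
      using w Z by (subst sum_ennreal[symmetric]) (auto intro!: sum.cong less_imp_le)
    also have "(\<Sum>s\<in>S. w s / Z) = 1"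
      using Z by (simp add: sum_divide_distrib[symmetric] Z_def)
    finally show "(\<integral>\<^sup>+ s. ennreal (if s \<in> S then w s / Z else 0) \<partial>count_space UNIV) = 1" by simp
  qed
  show set: "set_pmf ?p = S" using w Z by (force simp: set_pmf_eq p)
  have "measure_pmf.prob ?p {s. P s} = measure_pmf.prob ?p {s \<in> S. P s}"
    by (rule measure_eq_AE) (auto simp: AE_measure_pmf_iff set)
  also have "\<dots> = (\<Sum>s | s \<in> S \<and> P s. pmf ?p s)"
    using S(1) by (simp add: measure_measure_pmf_finite)
  also have "\<dots> = (\<Sum>s | s \<in> S \<and> P s. w s) / Z"
    by (simp add: p sum_divide_distrib)
  finally show "measure_pmf.prob ?p {s. P s} = (\<Sum>s | s \<in> S \<and> P s. w s) / sum w S"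
    by (simp add: Z_def)
qed

text \<open>A sample \<open>(i, x, v)\<close> stands for the pair of \<open>x\<close> and \<open>x(i := v)\<close>, which lie on a
  common line in direction \<open>i\<close>.\<close>

type_synonym sample = "nat \<times> (nat \<Rightarrow> nat) \<times> nat"

primrec pair_tester :: "sample pmf \<Rightarrow> nat \<Rightarrow> (nat \<Rightarrow> nat, real) query_alg" where
  "pair_tester p 0 = Output True"
| "pair_tester p (Suc t) = Flip (map_pmf (\<lambda>(i, x, v). Query x (\<lambda>a. Query (x(i := v)) (\<lambda>b.
     if violates (x i) v a b then Output False else pair_tester p t))) p)"

lemma query_points_pair_tester:
  assumes "\<And>i x v. (i, x, v) \<in> set_pmf p \<Longrightarrow> x \<in> D \<and> x(i := v) \<in> D"
  shows "query_points (pair_tester p t) \<subseteq> D"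
proof (induction t)
  case (Suc t)
  then show ?case using assms by (fastforce split: if_splits)
qed simp

text \<open>Fusing the two query nodes into a shift by 2 reduces a round to a test of
  \<open>violated\<close>, the form that the inductions on the number of rounds work with.\<close>

lemma run_pair_tester_Suc:
  "run f (pair_tester p (Suc t)) = bind_pmf p (\<lambda>(i, x, v).
     map_pmf (\<lambda>(b, q). (b, q + 2))
       (if violated f i x v then return_pmf (False, 0)
        else run f (pair_tester p t)))"
  by (auto simp: violated_def map_pmf_comp bind_map_pmf join_pmf_def bind_pmf_def[symmetric] pmf.map_comp o_def case_prod_beta
    intro!: bind_pmf_cong map_pmf_cong)

lemma queries_pair_tester:
  "(b, q) \<in> set_pmf (run f (pair_tester p t)) \<Longrightarrow> q \<le> 2 * t"
proof (induction t arbitrary: b q)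
  case (Suc t)
  then show ?case unfolding run_pair_tester_Suc
    by (fastforce split: if_splits)
qed simp

text \<open>The rounds draw independent samples, and acceptance means that none of them is
  violated.\<close>

lemma accept_pair_tester:
  "prob_output f (pair_tester p t) True =
     (1 - measure_pmf.prob p {(i, x, v). violated f i x v}) ^ t"
proof (induction t)
  case (Suc t)
  let ?viol = "{(i, x, v). violated f i x v}"
  have "map_pmf fst (run f (pair_tester p (Suc t))) = bind_pmf p (\<lambda>s.
      if s \<in> ?viol then return_pmf False else map_pmf fst (run f (pair_tester p t)))"
    unfolding run_pair_tester_Suc map_bind_pmf
    by (intro bind_pmf_cong) (auto simp: pmf.map_comp o_def case_prod_beta)
  then have "prob_output f (pair_tester p (Suc t)) True =
      (LINT s|measure_pmf p. pmf (if s \<in> ?viol then return_pmf False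
         else map_pmf fst (run f (pair_tester p t))) True)"
    by (simp only: prob_output_def pmf_bind)
  also have "\<dots> = (LINT s|measure_pmf p. indicator (- ?viol) s * prob_output f (pair_tester p t) True)"
    by (intro Bochner_Integration.integral_cong) (simp_all add: prob_output_def)
  also have "\<dots> = measure_pmf.prob p (- ?viol) * prob_output f (pair_tester p t) True"
    by simp
  also have "measure_pmf.prob p (- ?viol) = 1 - measure_pmf.prob p ?viol"
    using measure_pmf.prob_compl[of ?viol p] by (simp add: Compl_eq_Diff_UNIV)
  finally show ?case by (simp only: Suc power_Suc)
qed (simp add: prob_output_def)

lemma prob_output_False: "prob_output f A False = 1 - prob_output f A True"
proof -
  have "(\<Sum>b\<in>UNIV. pmf (map_pmf fst (run f A)) b) = 1" by (rule sum_pmf_eq_1) auto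
  then show ?thesis by (simp add: UNIV_bool prob_output_def)
qed


section \<open>Total weight of the samples\<close>

text \<open>The difference between \<open>harm n\<close> and \<open>ln n\<close> decreases and
  equals 1 at \<open>n = 1\<close>.\<close>

lemma harm_le_ln: "n \<ge> 1 \<Longrightarrow> harm n \<le> 1 + ln (real n)"
  using decseqD[OF decseq_harm_diff_ln, of 0 "n - 1"] by (simp add: harm_Suc harm_expand)

lemma sum_wt_le:
  assumes u: "u \<in> {1..n}"
  shows "(\<Sum>v\<in>{1..n}. wt u v) \<le> 2 * harm n"
proof -
  have nn: "0 \<le> wt u v" for v by (rule less_imp_le[OF wt_pos])
  have "(\<Sum>v\<in>{1..n}. wt u v) = (\<Sum>v\<in>{1..u} \<union> {u<..n}. wt u v)"
    using u by (intro sum.cong) auto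
  also have "\<dots> = (\<Sum>v\<in>{1..u}. wt u v) + (\<Sum>v\<in>{u<..n}. wt u v)"
    by (intro sum.union_disjoint) auto
  \<comment> \<open>Counting \<open>u\<close> a second time makes the upper side a full harmonic sum
    as well.\<close>
  also have "(\<Sum>v\<in>{u<..n}. wt u v) \<le> (\<Sum>v\<in>{u..n}. wt u v)"
    using nn by (intro sum_mono2) auto
  also have "(\<Sum>v\<in>{1..u}. wt u v) = harm u"
    unfolding harm_def
    by (rule sum.reindex_bij_witness[of _ "\<lambda>k. u + 1 - k" "\<lambda>v. u + 1 - v"])
      (auto simp: wt_def divide_inverse of_nat_diff add_ac)
  also have "(\<Sum>v\<in>{u..n}. wt u v) = harm (n + 1 - u)"
    unfolding harm_def using u
    by (intro sum.reindex_bij_witness[of _ "\<lambda>k. k + u - 1" "\<lambda>v. v + 1 - u"])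
      (auto simp: wt_def divide_inverse of_nat_diff add_ac)
  also have "harm u \<le> (harm n :: real)" using u by (intro harm_mono) auto
  also have "harm (n + 1 - u) \<le> (harm n :: real)" using u by (intro harm_mono) auto
  finally show ?thesis by simp
qed

section \<open>Violation probability of functions far from monotone\<close>

text \<open>The rank of a value is an integer function with the same order relations as
  \<open>g\<close>. A monotone function close to \<open>rank\<close> is carried back to the reals by
  a monotone map \<open>val\<close> that sends each rank to its value.\<close>

lemma dimension_reduction_real:
  fixes g :: "(nat \<Rightarrow> nat) \<Rightarrow> real"
  assumes V: "\<And>i. i \<in> {1..d} \<Longrightarrow> V i \<subseteq> hypergrid n d"
    and cover: "\<And>i x v. i \<in> {1..d} \<Longrightarrow> x \<in> hypergrid n d \<Longrightarrow> v \<in> {1..n} \<Longrightarrow> x i < v \<Longrightarrow>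
      g (x(i := v)) < g x \<Longrightarrow> x \<in> V i \<or> x(i := v) \<in> V i"
  shows "\<exists>h. grid_monotone n d h \<and>
    card {x \<in> hypergrid n d. g x \<noteq> h x} \<le> 4 * (\<Sum>i\<in>{1..d}. card (V i))"
proof -
  let ?D = "hypergrid n d"
  define rank where "rank x = int (card {y \<in> ?D. g y < g x})" for x
  have rank_mono: "rank x \<le> rank y" if "g x \<le> g y" for x y
    unfolding rank_def using that by (intro of_nat_mono card_mono) auto
  have rank_less: "rank x < rank y" if "x \<in> ?D" "g x < g y" for x y
    unfolding rank_def using that
    by (intro iffD2[OF of_nat_less_iff] psubset_card_mono) auto
  have "\<exists>h :: (nat \<Rightarrow> nat) \<Rightarrow> int. monotone_on ?D (grid_le d) (\<le>) h \<and>
    card {x \<in> ?D. rank x \<noteq> h x} \<le> 4 * (\<Sum>i\<in>{1..d}. card (V i))"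
  proof (rule dimension_reduction)
    fix i x v
    assume "i \<in> {1..d}" "x \<in> ?D" "v \<in> {1..n}" "x i < v" "rank (x(i := v)) < rank x"
    then show "x \<in> V i \<or> x(i := v) \<in> V i"
      using cover rank_mono by (meson not_less)
  qed (use V in auto)
  then obtain h :: "(nat \<Rightarrow> nat) \<Rightarrow> int" where h: "monotone_on ?D (grid_le d) (\<le>) h"
    and card_h: "card {x \<in> ?D. rank x \<noteq> h x} \<le> 4 * (\<Sum>i\<in>{1..d}. card (V i))" by blast
  \<comment> \<open>The inserted minimum keeps the set under \<open>Max\<close> nonempty when
    \<open>c\<close> lies below all ranks; it exceeds no value of \<open>g\<close>, so it leaves
    \<open>val (rank x)\<close> unchanged.\<close>
  define val where "val c = Max (insert (Min (g ` ?D)) {g y |y. y \<in> ?D \<and> rank y \<le> c})" for c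
  have val_mono: "val c \<le> val c'" if "c \<le> c'" for c c'
    unfolding val_def using that by (intro Max_mono) auto
  have val_rank: "val (rank x) = g x" if x: "x \<in> ?D" for x
    unfolding val_def
  proof (rule Max_eqI)
    fix r assume "r \<in> insert (Min (g ` ?D)) {g y |y. y \<in> ?D \<and> rank y \<le> rank x}"
    then consider "r = Min (g ` ?D)" | y where "y \<in> ?D" "rank y \<le> rank x" "r = g y" by blast
    then show "r \<le> g x"
    proof cases
      case 1
      then show ?thesis using x by simp
    next
      case 2
      then show ?thesis using rank_less[OF x, of y] by force
    qed
  qed (use x in auto)
  have "grid_monotone n d (\<lambda>x. val (h x))"
    unfolding grid_monotone_def using h val_mono by (auto simp: monotone_on_def)
  moreover have "{x \<in> ?D. g x \<noteq> val (h x)} \<subseteq> {x \<in> ?D. rank x \<noteq> h x}"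
    using val_rank by force
  then have "card {x \<in> ?D. g x \<noteq> val (h x)} \<le> card {x \<in> ?D. rank x \<noteq> h x}"
    by (intro card_mono) auto
  ultimately show ?thesis using card_h by (intro exI[of _ "\<lambda>x. val (h x)"]) simp
qed

text \<open>The one-point interval is a witness, as 1 < 2. Deleting the sparse points thus also
  disposes of every pair with an erased end.\<close>

lemma erased_subset_sparse:
  assumes i: "i \<in> {1..d}" and E: "E \<subseteq> hypergrid n d"
  shows "E \<subseteq> sparse n d i E"
proof
  fix x assume x: "x \<in> E"
  then have xi: "x i \<in> {1..n}" using E hypergrid_coord i by blast
  then have "line_section n i E x \<inter> {x i..x i} = {x i}" using x by (auto simp: line_section_def)
  then have "x i - x i + 1 < 2 * card (line_section n i E x \<inter> {x i..x i})" by simp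
  moreover have "x i \<in> {x i..n}" using xi by simp
  ultimately show "x \<in> sparse n d i E" using x E unfolding sparse_def by blast
qed

lemma far_imp_load:
  assumes d: "d \<ge> 1" and \<epsilon>: "0 < \<epsilon>" "\<epsilon> < 1" and \<alpha>: "\<alpha> \<le> \<epsilon> / (250 * real d)"
    and er: "erased_fun \<alpha> (hypergrid n d) f"
    and far: "far_from (hypergrid n d) (grid_monotone n d) \<epsilon> f"
  shows "3 / 50 * \<epsilon> * card (hypergrid n d) \<le> (\<Sum>i\<in>{1..d}. \<Sum>x\<in>hypergrid n d. load n f i x)"
proof -
  let ?D = "hypergrid n d"
  let ?N = "real (card ?D)"
  let ?W = "\<Sum>i\<in>{1..d}. \<Sum>x\<in>?D. load n f i x"
  define E where "E = {x \<in> ?D. f x = None}"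
  \<comment> \<open>Any restoration would do, since pairs involving erased points are covered by the
    sparse points in \<open>V\<close>.\<close>
  define g where "g x = (case f x of None \<Rightarrow> 0 | Some r \<Rightarrow> r)" for x
  define V where "V i = sparse n d i E \<union> {x \<in> ?D. 1/4 \<le> load n f i x}" for i
  have E: "E \<subseteq> ?D" by (auto simp: E_def)
  have "g \<in> restorations ?D f" by (auto simp: restorations_def nonerased_def g_def)
  have "\<exists>h. grid_monotone n d h \<and> card {x \<in> ?D. g x \<noteq> h x} \<le> 4 * (\<Sum>i\<in>{1..d}. card (V i))"
  proof (rule dimension_reduction_real)
    fix i x v
    assume *: "i \<in> {1..d}" "x \<in> ?D" "v \<in> {1..n}" "x i < v" "g (x(i := v)) < g x"
    have y: "x(i := v) \<in> ?D" using * by (intro hypergrid_upd) auto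
    show "x \<in> V i \<or> x(i := v) \<in> V i"
    proof (cases "x \<in> sparse n d i E \<or> x(i := v) \<in> sparse n d i E")
      case True
      then show ?thesis by (auto simp: V_def)
    next
      case False
      then have "x \<notin> E" "x(i := v) \<notin> E" using erased_subset_sparse[OF *(1) E] by auto
      then obtain r s where "f x = Some r" "f (x(i := v)) = Some s"
        using *(2) y by (auto simp: E_def)
      moreover from this have "s < r" using *(5) by (simp add: g_def)
      ultimately have "1/4 \<le> load n f i x \<or> 1/4 \<le> load n f i (x(i := v))"
        using False unfolding E_def by (intro violation_cover[OF *(1-4)]) auto
      then show ?thesis using *(2) y by (auto simp: V_def)
    qed
  qed (auto simp: V_def sparse_def)
  then obtain h where h: "grid_monotone n d h"
    and card_h: "card {x \<in> ?D. g x \<noteq> h x} \<le> 4 * (\<Sum>i\<in>{1..d}. card (V i))" by blast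
  have "real (card (V i)) \<le> 2 * card E + 4 * (\<Sum>x\<in>?D. load n f i x)" if i: "i \<in> {1..d}" for i
  proof -
    have "real (card (V i)) \<le> card (sparse n d i E) + card {x \<in> ?D. 1/4 \<le> load n f i x}"
      unfolding V_def of_nat_add[symmetric] by (intro of_nat_mono card_Un_le)
    then show ?thesis
      using card_sparse[OF i E] card_heavy[OF finite_hypergrid, of n d n f i] by linarith
  qed
  then have "(\<Sum>i\<in>{1..d}. real (card (V i))) \<le> (\<Sum>i\<in>{1..d}. 2 * card E + 4 * (\<Sum>x\<in>?D. load n f i x))"
    by (intro sum_mono)
  also have "\<dots> = 2 * (real d * card E) + 4 * ?W"
    by (simp add: sum.distrib sum_distrib_left)
  finally have V: "real (4 * (\<Sum>i\<in>{1..d}. card (V i))) \<le> 8 * (real d * card E) + 16 * ?W" by simp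
  have "\<epsilon> * card (nonerased ?D f) \<le> card {x \<in> nonerased ?D f. g x \<noteq> h x}"
    using far \<open>g \<in> restorations ?D f\<close> h by (auto simp: far_from_def)
  also have "\<dots> \<le> card {x \<in> ?D. g x \<noteq> h x}"
    by (intro of_nat_mono card_mono) (auto simp: nonerased_def)
  also have "\<dots> \<le> real (4 * (\<Sum>i\<in>{1..d}. card (V i)))" using card_h by (intro of_nat_mono)
  also note V
  finally have main: "\<epsilon> * card (nonerased ?D f) \<le> 8 * (real d * card E) + 16 * ?W" .
  have "real (card E) \<le> \<alpha> * ?N" using er by (simp add: erased_fun_def E_def)
  also have "\<dots> \<le> \<epsilon> / (250 * real d) * ?N" using \<alpha> by (intro mult_right_mono) auto
  finally have dE: "real d * card E \<le> \<epsilon> * ?N / 250" using d by (simp add: field_simps)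
  have "real (card E) \<le> real d * card E" using d by (simp add: mult_le_cancel_right1)
  also note dE
  also have "\<epsilon> * ?N / 250 \<le> ?N / 250" using \<epsilon> by (simp add: mult_left_le_one_le)
  finally have "real (card E) \<le> ?N / 250" .
  moreover have "nonerased ?D f = ?D - E" by (auto simp: nonerased_def E_def)
  then have "real (card (nonerased ?D f)) = ?N - card E"
    using E by (simp add: card_Diff_subset finite_subset card_mono of_nat_diff)
  ultimately have "249 / 250 * ?N \<le> card (nonerased ?D f)" by simp
  then have "\<epsilon> * (249 / 250 * ?N) \<le> \<epsilon> * card (nonerased ?D f)" using \<epsilon> by (intro mult_left_mono) auto
  \<comment> \<open>The remaining share is 241/250, and 241/250 divided by 16 is 0.06025, just above
    3/50.\<close>
  then have "249 / 250 * (\<epsilon> * ?N) \<le> 8 / 250 * (\<epsilon> * ?N) + 16 * ?W"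
    using main dE by (simp add: algebra_simps)
  moreover have "0 \<le> \<epsilon> * ?N" using \<epsilon> by simp
  ultimately show ?thesis by (simp add: mult.assoc)
qed

definition samples :: "nat \<Rightarrow> nat \<Rightarrow> sample set" where
  "samples n d = {1..d} \<times> hypergrid n d \<times> {1..n}"

definition sample_pmf :: "nat \<Rightarrow> nat \<Rightarrow> sample pmf" where
  "sample_pmf n d = weighted_pmf (samples n d) (\<lambda>(i, x, v). wt (x i) v)"

lemma hypergrid_nonempty: "n \<ge> 1 \<Longrightarrow> hypergrid n d \<noteq> {}"
  by (simp add: hypergrid_def PiE_eq_empty_iff)

lemma
  assumes "n \<ge> 1" "d \<ge> 1"
  shows set_sample_pmf: "set_pmf (sample_pmf n d) = samples n d"
    and prob_sample_pmf: "measure_pmf.prob (sample_pmf n d) {(i, x, v). violated f i x v} =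
      (\<Sum>i\<in>{1..d}. \<Sum>x\<in>hypergrid n d. load n f i x) /
      (\<Sum>i\<in>{1..d}. \<Sum>x\<in>hypergrid n d. \<Sum>v\<in>{1..n}. wt (x i) v)"
proof -
  let ?S = "samples n d" and ?w = "\<lambda>(i, x, v). wt (x i) v"
  have S: "finite ?S" "?S \<noteq> {}" using assms hypergrid_nonempty by (auto simp: samples_def)
  have w: "0 < ?w s" for s using wt_pos by (simp add: case_prod_beta)
  show "set_pmf (sample_pmf n d) = ?S"
    unfolding sample_pmf_def by (rule set_weighted_pmf[OF S w])
  have "(\<Sum>s | s \<in> ?S \<and> (case s of (i, x, v) \<Rightarrow> violated f i x v). ?w s) =
    (\<Sum>s\<in>?S. case s of (i, x, v) \<Rightarrow> if violated f i x v then wt (x i) v else 0)"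
    using S(1) by (simp add: sum.inter_filter case_prod_beta)
  also have "\<dots> = (\<Sum>i\<in>{1..d}. \<Sum>x\<in>hypergrid n d. \<Sum>v\<in>{1..n}. if violated f i x v then wt (x i) v else 0)"
    by (simp add: samples_def sum.cartesian_product)
  also have "\<dots> = (\<Sum>i\<in>{1..d}. \<Sum>x\<in>hypergrid n d. load n f i x)"
    by (simp only: load_def sum.inter_filter finite_atLeastAtMost)
  finally have num: "(\<Sum>s | s \<in> ?S \<and> (case s of (i, x, v) \<Rightarrow> violated f i x v). ?w s) = \<dots>" .
  have den: "sum ?w ?S = (\<Sum>i\<in>{1..d}. \<Sum>x\<in>hypergrid n d. \<Sum>v\<in>{1..n}. wt (x i) v)"
    by (simp add: samples_def sum.cartesian_product)
  show "measure_pmf.prob (sample_pmf n d) {(i, x, v). violated f i x v} =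
      (\<Sum>i\<in>{1..d}. \<Sum>x\<in>hypergrid n d. load n f i x) /
      (\<Sum>i\<in>{1..d}. \<Sum>x\<in>hypergrid n d. \<Sum>v\<in>{1..n}. wt (x i) v)"
    unfolding sample_pmf_def num[symmetric] den[symmetric] by (rule prob_weighted_pmf[OF S w])
qed

lemma far_imp_prob_violated:
  assumes n: "n \<ge> 2" and d: "d \<ge> 1" and \<epsilon>: "0 < \<epsilon>" "\<epsilon> < 1" and \<alpha>: "\<alpha> \<le> \<epsilon> / (250 * real d)"
    and er: "erased_fun \<alpha> (hypergrid n d) f"
    and far: "far_from (hypergrid n d) (grid_monotone n d) \<epsilon> f"
  shows "3 / 200 * (\<epsilon> / (real d * log 2 (real n))) \<le>
    measure_pmf.prob (sample_pmf n d) {(i, x, v). violated f i x v}"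
proof -
  let ?D = "hypergrid n d" and ?L = "log 2 (real n)"
  let ?Z = "\<Sum>i\<in>{1..d}. \<Sum>x\<in>?D. \<Sum>v\<in>{1..n}. wt (x i) v"
  let ?W = "\<Sum>i\<in>{1..d}. \<Sum>x\<in>?D. load n f i x"
  have N: "0 < real (card ?D)" using n hypergrid_nonempty[of n d] by (simp add: card_gt_0_iff)
  have L: "1 \<le> ?L" using n by (simp add: le_log_iff)
  have "ln (real n) = ?L * ln 2" using n by (simp add: log_def)
  also have "\<dots> \<le> ?L" using L ln_2_less_1 by (simp add: mult_left_le)
  finally have harm: "harm n \<le> 2 * ?L" using harm_le_ln[of n] n L by linarith
  have "?Z \<le> (\<Sum>i\<in>{1..d}. \<Sum>x\<in>?D. 4 * ?L)"
    using sum_wt_le harm hypergrid_coord by (intro sum_mono) (smt (verit))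
  also have "\<dots> = 4 * (real d * card ?D * ?L)" by simp
  finally have Z: "?Z \<le> 4 * (real d * card ?D * ?L)" .
  have "0 < ?Z"
    using n d N wt_pos by (intro sum_pos) (auto simp: card_gt_0_iff)
  have "3 / 200 * (\<epsilon> / (real d * ?L)) = (3 / 50 * \<epsilon> * M) / (4 * (real d * M * ?L))" if "0 < M" for M
    using that by simp
  from this[OF N] have "3 / 200 * (\<epsilon> / (real d * ?L)) =
      (3 / 50 * \<epsilon> * card ?D) / (4 * (real d * card ?D * ?L))" .
  also have "\<dots> \<le> (3 / 50 * \<epsilon> * card ?D) / ?Z"
    using Z \<open>0 < ?Z\<close> \<epsilon> N d L by (intro divide_left_mono mult_pos_pos) auto
  also have "\<dots> \<le> ?W / ?Z"
    using far_imp_load[OF d \<epsilon> \<alpha> er far] \<open>0 < ?Z\<close> by (intro divide_right_mono) auto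
  finally show ?thesis using prob_sample_pmf[of n d f] n d by simp
qed

section \<open>One-sided error, rejection and query count\<close>

lemma restorable_imp_not_violated:
  assumes "restorable (hypergrid n d) (grid_monotone n d) f" "(i, x, v) \<in> samples n d"
  shows "\<not> violated f i x v"
proof
  assume viol: "violated f i x v"
  obtain g where g: "g \<in> restorations (hypergrid n d) f" "grid_monotone n d g"
    using assms(1) by (auto simp: restorable_def)
  have i: "i \<in> {1..d}" and x: "x \<in> hypergrid n d" and v: "v \<in> {1..n}"
    using assms(2) by (auto simp: samples_def)
  have y: "x(i := v) \<in> hypergrid n d" using hypergrid_upd[OF x i v] .
  have mono: "g y \<le> g z" if "y \<in> hypergrid n d" "z \<in> hypergrid n d" "grid_le d y z" for y z
    using g(2) that by (auto simp: grid_monotone_def monotone_on_def)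
  obtain r s where "f x = Some r" "f (x(i := v)) = Some s" "x i < v \<and> s < r \<or> v < x i \<and> r < s"
    using viol by (auto simp: violated_def violates_def)
  moreover from this have "r = g x" "s = g (x(i := v))"
    using g(1) x y by (auto simp: restorations_def nonerased_def)
  moreover have "g x \<le> g (x(i := v))" if "x i < v"
    using mono[OF x y] that by (simp add: grid_le_def)
  moreover have "g (x(i := v)) \<le> g x" if "v < x i"
    using mono[OF y x] that by (simp add: grid_le_def)
  ultimately show False by force
qed

text \<open>For \<open>n = 1\<close> the bound \<open>log 2 n\<close> vanishes and the tester must
  accept without queries. This is sound: as \<alpha> < 1 the only point is nonerased, and every
  function on one point is monotone.\<close>

lemma not_far_singleton_grid:
  assumes "0 < \<epsilon>" "\<alpha> < 1" "erased_fun \<alpha> (hypergrid 1 d) f"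
  shows "\<not> far_from (hypergrid 1 d) (grid_monotone 1 d) \<epsilon> f"
proof
  assume far: "far_from (hypergrid 1 d) (grid_monotone 1 d) \<epsilon> f"
  define g where "g x = (case f x of None \<Rightarrow> 0 | Some r \<Rightarrow> r)" for x
  obtain z where z: "hypergrid (Suc 0) d = {z}" by (simp add: hypergrid_def PiE_singleton)
  have "f z \<noteq> None" using assms(2,3) by (cases "f z") (simp_all add: erased_fun_def z Collect_conv_if)
  then have "nonerased (hypergrid 1 d) f = {z}" by (auto simp: nonerased_def z)
  moreover have "g \<in> restorations (hypergrid 1 d) f"
    by (auto simp: restorations_def nonerased_def g_def)
  moreover have "grid_monotone 1 d g" by (simp add: grid_monotone_def z monotone_on_def)
  ultimately show False using far assms(1) by (fastforce simp: far_from_def)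
qed

theorem theorem4p1:
  shows "\<exists>(T :: nat \<Rightarrow> nat \<Rightarrow> real \<Rightarrow> real \<Rightarrow> (nat \<Rightarrow> nat, real) query_alg) (C :: real). C > 0 \<and>
    (\<forall>n d :: nat. \<forall>\<alpha> \<epsilon> :: real.
       n \<ge> 1 \<longrightarrow> d \<ge> 1 \<longrightarrow> 0 < \<alpha> \<longrightarrow> \<alpha> < 1 \<longrightarrow> 0 < \<epsilon> \<longrightarrow> \<epsilon> < 1 \<longrightarrow> \<alpha> \<le> \<epsilon> / (250 * real d) \<longrightarrow>
         erasure_resilient_tester (hypergrid n d) (grid_monotone n d) \<alpha> \<epsilon> (T n d \<alpha> \<epsilon>) \<and>
         one_sided (hypergrid n d) (grid_monotone n d) \<alpha> (T n d \<alpha> \<epsilon>) \<and>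
         query_complexity (hypergrid n d) \<alpha> (T n d \<alpha> \<epsilon>)
           \<le> ereal (C * (real d * log 2 (real n) / (\<epsilon> * (1 - \<alpha>)))))"
proof -
  \<comment> \<open>The factor 134 is the least integer whose product with 3/200 is at least 2,
    which makes the expected number of violated samples at least 2.\<close>
  define rounds where "rounds n d \<epsilon> = nat \<lceil>134 * (real d * log 2 (real n) / \<epsilon>)\<rceil>" for n d :: nat and \<epsilon> :: real
  define T where "T n d (\<alpha> :: real) \<epsilon> = pair_tester (sample_pmf n d) (rounds n d \<epsilon>)" for n d \<alpha> \<epsilon>
  have "erasure_resilient_tester (hypergrid n d) (grid_monotone n d) \<alpha> \<epsilon> (T n d \<alpha> \<epsilon>) \<and>
         one_sided (hypergrid n d) (grid_monotone n d) \<alpha> (T n d \<alpha> \<epsilon>) \<and>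
         query_complexity (hypergrid n d) \<alpha> (T n d \<alpha> \<epsilon>)
           \<le> ereal (270 * (real d * log 2 (real n) / (\<epsilon> * (1 - \<alpha>))))"
    if n: "n \<ge> 1" and d: "d \<ge> 1" and \<alpha>: "0 < \<alpha>" "\<alpha> < 1" and \<epsilon>: "0 < \<epsilon>" "\<epsilon> < 1"
      and \<alpha>\<epsilon>: "\<alpha> \<le> \<epsilon> / (250 * real d)" for n d \<alpha> \<epsilon>
  proof -
    let ?D = "hypergrid n d" and ?t = "rounds n d \<epsilon>"
    define X where "X = real d * log 2 (real n) / \<epsilon>"
    define q where "q f = measure_pmf.prob (sample_pmf n d) {(i, x, v). violated f i x v}" for f
    have X: "0 \<le> X" using n \<epsilon> by (simp add: X_def)
    have t: "134 * X \<le> ?t" "?t \<le> 134 * X + 1"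
      using X unfolding rounds_def X_def[symmetric] by linarith+
    have accept: "prob_output f (T n d \<alpha> \<epsilon>) True = 1"
      if "restorable ?D (grid_monotone n d) f" for f
    proof -
      have "set_pmf (sample_pmf n d) \<inter> {(i, x, v). violated f i x v} = {}"
        using restorable_imp_not_violated[OF that] set_sample_pmf[OF n d] by auto
      then have "q f = 0" by (simp add: q_def measure_pmf_zero_iff)
      then show ?thesis by (simp add: T_def accept_pair_tester q_def)
    qed
    have reject: "2 / 3 \<le> prob_output f (T n d \<alpha> \<epsilon>) False"
      if er: "erased_fun \<alpha> ?D f" and far: "far_from ?D (grid_monotone n d) \<epsilon> f" for f
    proof -
      have "n \<noteq> 1" using not_far_singleton_grid \<epsilon>(1) \<alpha>(2) er far by blast
      then have n2: "n \<ge> 2" using n by simp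
      have q: "3 / 200 * (\<epsilon> / (real d * log 2 (real n))) \<le> q f" "q f \<le> 1" "0 \<le> q f"
        using far_imp_prob_violated[OF n2 d \<epsilon> \<alpha>\<epsilon> er far] by (simp_all add: q_def)
      have "0 < X" using n2 d \<epsilon> by (simp add: X_def)
      have "2 \<le> 3 / 200 * (1 / X) * (134 * X)" using \<open>0 < X\<close> by simp
      also have "\<dots> \<le> q f * ?t"
        using q(1,3) t(1) \<open>0 < X\<close> by (intro mult_mono) (simp_all add: X_def)
      finally have qt: "2 \<le> ?t * q f" by (simp add: mult.commute)
      have "(1 - q f) ^ ?t \<le> exp (- q f) ^ ?t"
        using q(2) exp_ge_add_one_self[of "- q f"] by (intro power_mono) auto
      also have "\<dots> = exp (- (?t * q f))" by (simp add: exp_of_nat_mult[symmetric])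
      also have "\<dots> \<le> exp (- 2)" using qt by simp
      also have "\<dots> = 1 / exp 2" by (simp add: exp_minus divide_inverse)
      \<comment> \<open>The estimate \<open>exp 2 \<ge> 1 + 2\<close> suffices.\<close>
      also have "\<dots> \<le> 1 / 3" using exp_ge_add_one_self[of 2] by (simp add: field_simps)
      finally show ?thesis
        by (simp add: prob_output_False T_def accept_pair_tester q_def)
    qed
    have "query_points (T n d \<alpha> \<epsilon>) \<subseteq> ?D"
      unfolding T_def using set_sample_pmf[OF n d] hypergrid_upd
      by (intro query_points_pair_tester) (auto simp: samples_def)
    moreover have "query_complexity ?D \<alpha> (T n d \<alpha> \<epsilon>) \<le> ereal (270 * (real d * log 2 (real n) / (\<epsilon> * (1 - \<alpha>))))"
      unfolding query_complexity_def
    proof (intro SUP_least, clarify)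
      fix f b k
      assume "(b, k) \<in> set_pmf (run f (T n d \<alpha> \<epsilon>))"
      then have k: "k \<le> 2 * ?t" unfolding T_def by (rule queries_pair_tester)
      \<comment> \<open>Two queries in each of at most \<open>134 * X + 1\<close> rounds give
        \<open>268 * X + 2\<close>, and \<open>X \<ge> 1\<close> absorbs the rounding. For
        \<open>n = 1\<close> there are no rounds.\<close>
      have "real k \<le> 270 * X"
      proof (cases "n = 1")
        case True
        then show ?thesis using k by (simp add: rounds_def X_def)
      next
        case False
        then have "1 \<le> log 2 (real n)" using n by (simp add: le_log_iff)
        then have "1 * 1 \<le> real d * log 2 (real n)" using d by (intro mult_mono) auto
        then have "1 \<le> X" using \<epsilon> by (simp add: X_def)
        then show ?thesis using k t(2) by linarith
      qed
      also have "X \<le> X / (1 - \<alpha>)" using X \<alpha> by (simp add: le_divide_eq mult_left_le)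
      also have "X / (1 - \<alpha>) = real d * log 2 (real n) / (\<epsilon> * (1 - \<alpha>))" by (simp add: X_def)
      finally show "ereal (real k) \<le> ereal (270 * (real d * log 2 (real n) / (\<epsilon> * (1 - \<alpha>))))" by simp
    qed
    ultimately show ?thesis
      using accept reject by (simp add: erasure_resilient_tester_def one_sided_def)
  qed
  then show ?thesis by (intro exI[of _ T] exI[of _ 270]) simp
qed

end
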